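(* There are complex Kleinian groups acting on $\mathbb{P}^2_{\mathbb{C}}$ which are neither conjugate to complex hyperbolic groups nor virtually affine groups.
   Context: $\mathrm{PSL}(3,\mathbb{C})=\mathrm{GL}(3,\mathbb{C})/\mathbb{C}^*$ acts on $\mathbb{P}^2_{\mathbb{C}}$. A subgroup of $\mathrm{PSL}(3,\mathbb{C})$ is complex Kleinian if it acts properly discontinuously on some non-empty invariant open subset of $\mathbb{P}^2_{\mathbb{C}}$. A complex hyperbolic group is a subgroup of $\mathrm{PU}(2,1)$, the projectivization of $\mathrm{U}(2,1)=\{g\in\mathrm{GL}(3,\mathbb{C}): g^*Hg=H\}$ with $H=\begin{pmatrix}0&0&1\\0&1&0\\1&0&0\end{pmatrix}$. A group is virtually affine if it has a finite-index subgroup which leaves invariant a complex line of $\mathbb{P}^2_{\mathbb{C}}$ (equivalently, is conjugate to a group of affine transformations of $\mathbb{C}^2$). Conjugacy is in $\mathrm{PSL}(3,\mathbb{C})$. *)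

theory Defs
  imports "HOL-Analysis.Analysis" "HOL-Algebra.Coset"
begin

definition GL3 :: "(complex^3^3) monoid" where
  "GL3 = \<lparr>carrier = {A. invertible A}, monoid.mult = (**), one = mat 1\<rparr>"

definition scalars3 :: "(complex^3^3) set" where
  "scalars3 = {mat c |c. c \<noteq> 0}"

text \<open>Elements of \<open>PSL3\<close> are cosets, i.e. sets of matrices that agree up to a nonzero factor.\<close>

definition PSL3 :: "(complex^3^3) set monoid" where
  "PSL3 = GL3 Mod scalars3"

lemma mat_matrix_mult: "mat c ** (A :: complex^3^3) = (\<chi> i j. c * A $ i $ j)"
  by (simp add: vec_eq_iff matrix_matrix_mult_def mat_def if_distrib if_distribR cong: if_cong)

lemma matrix_mult_mat: "(A :: complex^3^3) ** mat c = (\<chi> i j. c * A $ i $ j)"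
  by (simp add: vec_eq_iff matrix_matrix_mult_def mat_def if_distrib if_distribR mult.commute
      cong: if_cong)

lemma mat_vector_mult: "mat c *v (v :: complex^3) = c *s v"
  by (simp add: vec_eq_iff matrix_vector_mult_def mat_def if_distrib if_distribR cong: if_cong)

lemma mat_mult_mat: "mat c ** mat d = (mat (c * d) :: complex^3^3)"
  unfolding mat_matrix_mult by (simp add: vec_eq_iff mat_def)

lemma invertible_mat: "c \<noteq> 0 \<Longrightarrow> invertible (mat c :: complex^3^3)"
  unfolding invertible_def by (intro exI[of _ "mat (inverse c)"]) (simp add: mat_mult_mat)

lemma group_GL3: "group GL3"
proof (rule groupI)
  fix A assume "A \<in> carrier GL3"
  then obtain B where "A ** B = mat 1" "B ** A = mat 1"
    by (auto simp: GL3_def invertible_def)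
  then show "\<exists>B\<in>carrier GL3. B \<otimes>\<^bsub>GL3\<^esub> A = \<one>\<^bsub>GL3\<^esub>"
    by (auto simp: GL3_def invertible_def)
qed (auto simp: GL3_def invertible_mult matrix_mul_assoc invertible_mat)

lemma subgroup_scalars3: "subgroup scalars3 GL3"
proof (rule group.subgroupI[OF group_GL3])
  fix A assume "A \<in> scalars3"
  then obtain c where c: "A = mat c" "c \<noteq> 0" by (auto simp: scalars3_def)
  have "inv\<^bsub>GL3\<^esub> A = mat (inverse c)"
    using c by (intro group.inv_equality[OF group_GL3]) (auto simp: GL3_def mat_mult_mat invertible_mat)
  then show "inv\<^bsub>GL3\<^esub> A \<in> scalars3"
    using c by (auto simp: scalars3_def intro!: exI[of _ "inverse c"])
next
  fix A B assume "A \<in> scalars3" "B \<in> scalars3"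
  then show "A \<otimes>\<^bsub>GL3\<^esub> B \<in> scalars3"
    by (force simp: scalars3_def GL3_def mat_mult_mat)
next
  show "scalars3 \<noteq> {}" unfolding scalars3_def by (auto intro: exI[of _ 1])
qed (auto simp: scalars3_def GL3_def invertible_mat)

lemma normal_scalars3: "scalars3 \<lhd> GL3"
proof -
  have "scalars3 #>\<^bsub>GL3\<^esub> A = A <#\<^bsub>GL3\<^esub> scalars3" for A
    by (auto simp: scalars3_def GL3_def r_coset_def l_coset_def mat_matrix_mult matrix_mult_mat)
  then show ?thesis
    by (simp add: group.normalI[OF group_GL3 subgroup_scalars3])
qed

lemma group_PSL3: "group PSL3"
  unfolding PSL3_def by (rule normal.factorgroup_is_group[OF normal_scalars3])

text \<open>Points are the complex lines through the origin, and the topology is the quotient topology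
  from the nonzero vectors. The unqualified constants \<open>span\<close>, \<open>subspace\<close>, \<open>dim\<close> refer to
  the real vector space structure; those with prefix \<open>vec\<close> are over the complex numbers.\<close>

definition proj_pt :: "complex^3 \<Rightarrow> (complex^3) set" where
  "proj_pt v = vec.span {v}"

definition P2 :: "(complex^3) set set" where
  "P2 = proj_pt ` (- {0})"

definition P2_top :: "(complex^3) set topology" where
  "P2_top = topology (\<lambda>U. U \<subseteq> P2 \<and> open {v. v \<noteq> 0 \<and> proj_pt v \<in> U})"

lemma openin_P2_top: "openin P2_top U \<longleftrightarrow> U \<subseteq> P2 \<and> open {v. v \<noteq> 0 \<and> proj_pt v \<in> U}"
proof -
  have "istopology (\<lambda>U. U \<subseteq> P2 \<and> open {v. v \<noteq> 0 \<and> proj_pt v \<in> U})"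
    unfolding istopology_def
  proof (intro conjI allI impI)
    fix S T assume *: "S \<subseteq> P2 \<and> open {v. v \<noteq> 0 \<and> proj_pt v \<in> S}"
      "T \<subseteq> P2 \<and> open {v. v \<noteq> 0 \<and> proj_pt v \<in> T}"
    have "{v. v \<noteq> 0 \<and> proj_pt v \<in> S \<inter> T}
        = {v. v \<noteq> 0 \<and> proj_pt v \<in> S} \<inter> {v. v \<noteq> 0 \<and> proj_pt v \<in> T}" by auto
    with * show "open {v. v \<noteq> 0 \<and> proj_pt v \<in> S \<inter> T}" by (simp add: open_Int)
  next
    fix K assume *: "\<forall>S\<in>K. S \<subseteq> P2 \<and> open {v. v \<noteq> 0 \<and> proj_pt v \<in> S}"
    have "{v. v \<noteq> 0 \<and> proj_pt v \<in> \<Union>K} = (\<Union>S\<in>K. {v. v \<noteq> 0 \<and> proj_pt v \<in> S})" by auto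
    with * show "open {v. v \<noteq> 0 \<and> proj_pt v \<in> \<Union>K}" by (simp add: open_UN)
  qed auto
  then show ?thesis by (simp add: P2_top_def topology_inverse')
qed

lemma topspace_P2_top: "topspace P2_top = P2"
proof -
  have "{v. v \<noteq> 0 \<and> proj_pt v \<in> P2} = - {0}" by (auto simp: P2_def)
  then have "openin P2_top P2" by (simp add: openin_P2_top open_Compl)
  then show ?thesis by (metis openin_P2_top openin_subset openin_topspace subset_antisym)
qed

lemma quotient_map_proj_pt: "quotient_map (top_of_set (- {0})) P2_top proj_pt"
proof -
  have "openin (top_of_set (- {0})) {v \<in> - {0}. proj_pt v \<in> U}
      \<longleftrightarrow> open {v. v \<noteq> 0 \<and> proj_pt v \<in> U}" for U
    by (subst openin_open_eq) (auto simp: open_Compl)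
  then show ?thesis
    unfolding quotient_map_def by (auto simp: topspace_P2_top openin_P2_top P2_def)
qed

text \<open>All matrices in a class have the same effect on a complex line through the origin, so the
  union below is the image of that line under any representative; see \<open>act_proj_pt\<close>.\<close>

definition act :: "(complex^3^3) set \<Rightarrow> (complex^3) set \<Rightarrow> (complex^3) set" where
  "act g p = (\<Union>A\<in>g. (*v) A ` p)"

lemma act_proj_pt: "act (scalars3 #>\<^bsub>GL3\<^esub> A) (proj_pt v) = proj_pt (A *v v)"
proof -
  have *: "(mat c ** A) *v (k *s v) = (c * k) *s (A *v v)" for c k
    by (simp add: matrix_vector_mul_assoc[symmetric] mat_vector_mult vec.scale vec.scale_scale)
  have "act (scalars3 #>\<^bsub>GL3\<^esub> A) (proj_pt v)
      = {(mat c ** A) *v (k *s v) |c k. c \<noteq> 0}"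
    unfolding act_def proj_pt_def scalars3_def GL3_def r_coset_def vec.span_singleton by auto
  also have "\<dots> = {(c * k) *s (A *v v) |c k. c \<noteq> 0}"
    by (simp only: *)
  also have "\<dots> = proj_pt (A *v v)"
    unfolding proj_pt_def vec.span_singleton by auto (metis mult_1 zero_neq_one)
  finally show ?thesis .
qed

definition proj_line :: "(complex^3) set set \<Rightarrow> bool" where
  "proj_line l \<longleftrightarrow> (\<exists>W. vec.subspace W \<and> vec.dim W = 2 \<and> l = {p \<in> P2. p \<subseteq> W})"

definition properly_discontinuous_on ::
    "(complex^3^3) set set \<Rightarrow> (complex^3) set set \<Rightarrow> bool" where
  "properly_discontinuous_on G \<Omega> \<longleftrightarrow>
     (\<forall>K. compactin P2_top K \<and> K \<subseteq> \<Omega> \<longrightarrow> finite {g \<in> G. act g ` K \<inter> K \<noteq> {}})"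

definition complex_kleinian :: "(complex^3^3) set set \<Rightarrow> bool" where
  "complex_kleinian G \<longleftrightarrow> subgroup G PSL3 \<and>
     (\<exists>\<Omega>. openin P2_top \<Omega> \<and> \<Omega> \<noteq> {} \<and> (\<forall>g\<in>G. act g ` \<Omega> = \<Omega>) \<and>
          properly_discontinuous_on G \<Omega>)"

definition H21 :: "complex^3^3" where
  "H21 = vector [vector [0, 0, 1], vector [0, 1, 0], vector [1, 0, 0]]"

definition adjoint_mat :: "complex^3^3 \<Rightarrow> complex^3^3" where
  "adjoint_mat A = (\<chi> i j. cnj (A $ j $ i))"

definition U21 :: "(complex^3^3) set" where
  "U21 = {A. invertible A \<and> adjoint_mat A ** H21 ** A = H21}"

definition PU21 :: "(complex^3^3) set set" where
  "PU21 = (\<lambda>A. scalars3 #>\<^bsub>GL3\<^esub> A) ` U21"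

definition complex_hyperbolic :: "(complex^3^3) set set \<Rightarrow> bool" where
  "complex_hyperbolic G \<longleftrightarrow> subgroup G PSL3 \<and> G \<subseteq> PU21"

definition conjugate_in_PSL3 :: "(complex^3^3) set set \<Rightarrow> (complex^3^3) set set \<Rightarrow> bool" where
  "conjugate_in_PSL3 G K \<longleftrightarrow>
     (\<exists>c\<in>carrier PSL3. K = (\<lambda>g. c \<otimes>\<^bsub>PSL3\<^esub> g \<otimes>\<^bsub>PSL3\<^esub> inv\<^bsub>PSL3\<^esub> c) ` G)"

definition virtually_affine :: "(complex^3^3) set set \<Rightarrow> bool" where
  "virtually_affine G \<longleftrightarrow> subgroup G PSL3 \<and>
     (\<exists>N. subgroup N (PSL3\<lparr>carrier := G\<rparr>) \<and> finite (rcosets\<^bsub>PSL3\<lparr>carrier := G\<rparr>\<^esub> N) \<and>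
          (\<exists>l. proj_line l \<and> (\<forall>g\<in>N. act g ` l = l)))"

end

theory Submission
  imports Defs
begin

text \<open>
  The group is the image in \<open>PSL3\<close> of the Jacobi group \<open>SL(2,\<int>) \<ltimes> \<int>\<^sup>2\<close>, realised by the matrices
  with first column \<open>e\<^sub>1\<close>, lower right block in \<open>SL(2,\<int>)\<close> and integer entries \<open>p\<close>, \<open>q\<close> in the
  rest of the first row. They act by \<open>(x, z, w) \<mapsto> (x + pz + qw, az + bw, cz + dw)\<close>.

  Kleinian: the group acts on the set \<open>jacobi_domain\<close> of those points with \<open>Im (z * cnj w) \<noteq> 0\<close>, which
  fibres over the upper and lower half planes with the parameter \<open>z / w\<close>: \<open>SL(2,\<int>)\<close> acts properly
  discontinuously on the base, and \<open>\<int>\<^sup>2\<close> acts on the fibre by the lattice \<open>\<int>z + \<int>w\<close>. The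
  quantitative form of this is short. The number \<open>D = \<bar>Im (z * cnj w)\<bar>\<close> is invariant, and on a compact
  set \<open>\<parallel>v\<parallel>\<^sup>2 \<le> M D\<close> for some \<open>M\<close>. If \<open>v\<close> and \<open>gv\<close> both satisfy this bound, then, for example,
  \<open>\<bar>c\<bar> D = \<bar>Im ((cz + dw) * cnj w)\<bar> \<le> M D\<close>, so that all entries of \<open>g\<close> are bounded
  (\<open>jacobi_entries_bounded\<close>).

  Not virtually affine: a subgroup of finite index contains \<open>1 + kE\<close> with \<open>k > 0\<close> for each of the
  elementary matrices \<open>E\<^sub>1\<^sub>2\<close>, \<open>E\<^sub>1\<^sub>3\<close>, \<open>E\<^sub>2\<^sub>3\<close>, \<open>E\<^sub>3\<^sub>2\<close>, so that the plane in \<open>\<complex>\<^sup>3\<close> belonging to an invariant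
  line would be stable under these four. No plane is (\<open>no_jacobi_stable_plane\<close>).

  Not conjugate to a complex hyperbolic group: the group fixes the point \<open>[e\<^sub>1]\<close>, and the
  orthogonal complement of a fixed point with respect to an invariant nondegenerate Hermitian form
  would be an invariant line. In terms of the Gram matrix, invariance up to a factor forces its
  first row to vanish.
\<close>

section \<open>The Jacobi group as a subgroup of the projective linear group\<close>

text \<open>The first two arguments are the translation part, the other four the lower right block.\<close>

definition jacobi_mat :: "int \<Rightarrow> int \<Rightarrow> int \<Rightarrow> int \<Rightarrow> int \<Rightarrow> int \<Rightarrow> complex^3^3" where
  "jacobi_mat p q a b c d = vector [vector [1, of_int p, of_int q],
     vector [0, of_int a, of_int b], vector [0, of_int c, of_int d]]"

text \<open>The Jacobi group \<open>SL(2,\<int>) \<ltimes> \<int>\<^sup>2\<close> inside \<open>GL3\<close>.\<close>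

definition jacobi_matrices :: "(complex^3^3) set" where
  "jacobi_matrices = {jacobi_mat p q a b c d |p q a b c d. a * d - b * c = 1}"

text \<open>The class of an invertible matrix in \<open>PSL3\<close>.\<close>

abbreviation proj_class :: "complex^3^3 \<Rightarrow> (complex^3^3) set" where
  "proj_class A \<equiv> scalars3 #>\<^bsub>GL3\<^esub> A"

text \<open>The image of the Jacobi group in \<open>PSL3\<close>.\<close>

definition jacobi_group :: "(complex^3^3) set set" where
  "jacobi_group = proj_class ` jacobi_matrices"

lemma jacobi_mat_mem: "a * d - b * c = 1 \<Longrightarrow> jacobi_mat p q a b c d \<in> jacobi_matrices"
  unfolding jacobi_matrices_def by blast

lemma jacobi_mat_mult:
  "jacobi_mat p q a b c d ** jacobi_mat p' q' a' b' c' d' =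
   jacobi_mat (p' + p * a' + q * c') (q' + p * b' + q * d')
     (a * a' + b * c') (a * b' + b * d') (c * a' + d * c') (c * b' + d * d')"
  by (simp add: jacobi_mat_def vec_eq_iff matrix_matrix_mult_def forall_3 sum_3)

lemma jacobi_mat_vector:
  "jacobi_mat p q a b c d *v v = vector [v $ 1 + of_int p * v $ 2 + of_int q * v $ 3,
     of_int a * v $ 2 + of_int b * v $ 3, of_int c * v $ 2 + of_int d * v $ 3]"
  by (simp add: jacobi_mat_def vec_eq_iff matrix_vector_mult_def forall_3 sum_3)

lemma jacobi_mat_one: "jacobi_mat 0 0 1 0 0 1 = mat 1"
  by (simp add: jacobi_mat_def vec_eq_iff mat_def forall_3)

lemma jacobi_mat_inverse:
  assumes "a * d - b * c = 1"
  shows "jacobi_mat (q * c - p * d) (p * b - q * a) d (- b) (- c) a ** jacobi_mat p q a b c d = mat 1"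
    and "jacobi_mat p q a b c d ** jacobi_mat (q * c - p * d) (p * b - q * a) d (- b) (- c) a = mat 1"
proof -
  have ad: "a * d = 1 + b * c" "d * a = 1 + b * c" using assms by (simp_all add: mult.commute)
  have "p + (q * c - p * d) * a + (p * b - q * a) * c = p * (1 - (a * d - b * c))"
    "q + (q * c - p * d) * b + (p * b - q * a) * d = q * (1 - (a * d - b * c))"
    by (simp_all add: algebra_simps)
  then show "jacobi_mat (q * c - p * d) (p * b - q * a) d (- b) (- c) a ** jacobi_mat p q a b c d = mat 1"
    using assms ad unfolding jacobi_mat_mult jacobi_mat_one[symmetric]
    by (simp add: mult.commute)
  show "jacobi_mat p q a b c d ** jacobi_mat (q * c - p * d) (p * b - q * a) d (- b) (- c) a = mat 1"
    using assms ad unfolding jacobi_mat_mult jacobi_mat_one[symmetric]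
    by (simp add: algebra_simps)
qed

lemma jacobi_matrices_subset_GL3: "jacobi_matrices \<subseteq> carrier GL3"
  using jacobi_mat_inverse by (fastforce simp: jacobi_matrices_def GL3_def invertible_def)

lemma subgroup_jacobi_matrices: "subgroup jacobi_matrices GL3"
proof (rule group.subgroupI[OF group_GL3 jacobi_matrices_subset_GL3])
  have "jacobi_mat 0 0 1 0 0 1 \<in> jacobi_matrices"
    by (rule jacobi_mat_mem) simp
  then show "jacobi_matrices \<noteq> {}" by blast
next
  fix A assume A: "A \<in> jacobi_matrices"
  then obtain p q a b c d where *: "A = jacobi_mat p q a b c d" "a * d - b * c = 1"
    unfolding jacobi_matrices_def by blast
  define B where "B = jacobi_mat (q * c - p * d) (p * b - q * a) d (- b) (- c) a"
  have B: "B \<in> jacobi_matrices"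
    unfolding B_def using *(2) by (intro jacobi_mat_mem) (simp add: mult.commute)
  have "inv\<^bsub>GL3\<^esub> A = B"
    using A B jacobi_mat_inverse(1)[OF *(2), of q p] jacobi_matrices_subset_GL3
    by (intro group.inv_equality[OF group_GL3]) (auto simp: GL3_def * B_def)
  with B show "inv\<^bsub>GL3\<^esub> A \<in> jacobi_matrices" by simp
next
  fix A B assume "A \<in> jacobi_matrices" "B \<in> jacobi_matrices"
  then obtain p q a b c d p' q' a' b' c' d' where
    *: "A = jacobi_mat p q a b c d" "a * d - b * c = 1"
       "B = jacobi_mat p' q' a' b' c' d'" "a' * d' - b' * c' = 1"
    unfolding jacobi_matrices_def by blast
  have "(a * a' + b * c') * (c * b' + d * d') - (a * b' + b * d') * (c * a' + d * c')
      = (a * d - b * c) * (a' * d' - b' * c')" by (simp add: algebra_simps)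
  then have "A ** B \<in> jacobi_matrices"
    unfolding *(1,3) jacobi_mat_mult using *(2,4) by (intro jacobi_mat_mem) simp
  then show "A \<otimes>\<^bsub>GL3\<^esub> B \<in> jacobi_matrices" by (simp add: GL3_def)
qed

lemma group_hom_proj_class: "group_hom GL3 PSL3 proj_class"
  by (intro group_hom.intro group_GL3 group_PSL3 group_hom_axioms.intro)
    (simp add: PSL3_def normal.r_coset_hom_Mod[OF normal_scalars3])

lemma subgroup_jacobi_group: "subgroup jacobi_group PSL3"
  unfolding jacobi_group_def
  by (rule group_hom.subgroup_img_is_subgroup[OF group_hom_proj_class subgroup_jacobi_matrices])

lemma proj_class_mult:
  assumes "invertible A" "invertible B"
  shows "proj_class A \<otimes>\<^bsub>PSL3\<^esub> proj_class B = proj_class (A ** B)"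
  using group_hom.hom_mult[OF group_hom_proj_class, of A B] assms by (simp add: GL3_def)

lemma proj_class_inv:
  assumes "A ** B = mat 1" "B ** A = mat 1"
  shows "inv\<^bsub>PSL3\<^esub> proj_class A = proj_class B"
proof -
  have "inv\<^bsub>GL3\<^esub> A = B"
    using assms by (intro group.inv_equality[OF group_GL3]) (auto simp: GL3_def invertible_def)
  moreover have "A \<in> carrier GL3" using assms by (auto simp: GL3_def invertible_def)
  ultimately show ?thesis using group_hom.hom_inv[OF group_hom_proj_class, of A] by simp
qed

lemma mem_proj_class: "B \<in> proj_class A \<longleftrightarrow> (\<exists>k. k \<noteq> 0 \<and> B = mat k ** A)"
  by (auto simp: r_coset_def scalars3_def GL3_def)

section \<open>Proper discontinuity\<close>

text \<open>The area of the parallelogram that \<open>z = v $ 2\<close> and \<open>w = v $ 3\<close> span in the complex plane.\<close>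

definition area :: "complex^3 \<Rightarrow> real" where
  "area v = \<bar>Im (v $ 2 * cnj (v $ 3))\<bar>"

text \<open>The upper and lower half planes in the coordinate \<open>z / w\<close>, pulled back along the projection
  from the fixed point \<open>[e\<^sub>1]\<close>. The centre of projection itself is left out.\<close>

definition jacobi_domain :: "(complex^3) set set" where
  "jacobi_domain = proj_pt ` {v. area v \<noteq> 0}"

lemma area_scale: "area (k *s v) = (norm k)\<^sup>2 * area v"
proof -
  have "(k * v $ 2) * cnj (k * v $ 3) = of_real ((norm k)\<^sup>2) * (v $ 2 * cnj (v $ 3))"
    unfolding complex_norm_square by simp
  then have "Im ((k * v $ 2) * cnj (k * v $ 3)) = (norm k)\<^sup>2 * Im (v $ 2 * cnj (v $ 3))"
    by (simp only: Re_complex_of_real Im_complex_of_real times_complex.sel)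
  then show ?thesis
    unfolding area_def vector_smult_component by (simp only: abs_mult) simp
qed

lemma norm_scale_vec: "norm (k *s v) = norm k * norm (v :: complex^3)"
  by (simp add: norm_vec_def L2_set_def norm_mult power_mult_distrib sum_distrib_left[symmetric]
      real_sqrt_mult)

lemma proj_pt_eq_imp_scale:
  assumes "proj_pt v = proj_pt w" "v \<noteq> 0"
  obtains k where "k \<noteq> 0" "v = k *s w"
proof -
  have "v \<in> proj_pt w" using assms(1) by (metis proj_pt_def vec.span_base singletonI)
  then obtain k where "v = k *s w" by (auto simp: proj_pt_def vec.span_singleton)
  with assms(2) that show ?thesis by fastforce
qed

lemma area_jacobi:
  assumes "a * d - b * c = 1"
  shows "area (jacobi_mat p q a b c d *v v) = area v"
proof -
  have "real_of_int a * of_int d - of_int b * of_int c = 1"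
    using assms by (metis of_int_1 of_int_diff of_int_mult)
  moreover have "Im ((of_int a * z + of_int b * w) * cnj (of_int c * z + of_int d * w))
      = (of_int a * of_int d - of_int b * of_int c) * Im (z * cnj w)" for z w
    by (simp add: algebra_simps)
  ultimately show ?thesis by (simp add: jacobi_mat_vector area_def)
qed

text \<open>Both sides of the inequality are homogeneous of degree two, so that it defines a set of
  points. These sets exhaust \<open>jacobi_domain\<close> as \<open>M\<close> grows, and thus bound every compact subset.\<close>

lemma openin_area_bound:
  "openin P2_top (proj_pt ` {v. (norm v)\<^sup>2 < M * area v})"
proof -
  let ?S = "{v. (norm v)\<^sup>2 < M * area v}"
  have "v \<noteq> 0 \<and> proj_pt v \<in> proj_pt ` ?S \<longleftrightarrow> v \<in> ?S" for v
  proof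
    assume v: "v \<noteq> 0 \<and> proj_pt v \<in> proj_pt ` ?S"
    then obtain w where w: "proj_pt v = proj_pt w" "w \<in> ?S" by auto
    obtain k where k: "k \<noteq> 0" "v = k *s w" using proj_pt_eq_imp_scale w v by metis
    have "(norm k)\<^sup>2 * (norm w)\<^sup>2 < (norm k)\<^sup>2 * (M * area w)"
      using k(1) w(2) by (intro mult_strict_left_mono) auto
    then show "v \<in> ?S" by (simp add: k(2) area_scale norm_scale_vec power_mult_distrib ac_simps)
  qed (auto simp: area_def)
  then have "{v. v \<noteq> 0 \<and> proj_pt v \<in> proj_pt ` ?S} = ?S" by blast
  moreover have "open ?S"
    unfolding area_def by (intro open_Collect_less continuous_intros)
  moreover have "proj_pt ` ?S \<subseteq> P2"
  proof -
    have "0 \<notin> ?S" by (simp add: area_def)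
    then show ?thesis unfolding P2_def by blast
  qed
  ultimately show ?thesis by (simp add: openin_P2_top)
qed

lemma jacobi_domain_Union: "jacobi_domain = (\<Union>n::nat. proj_pt ` {v. (norm v)\<^sup>2 < real n * area v})"
proof -
  have "area v \<noteq> 0 \<longleftrightarrow> (\<exists>n::nat. (norm v)\<^sup>2 < real n * area v)" for v
  proof
    assume "area v \<noteq> 0"
    then have "area v > 0" by (auto simp: area_def)
    then show "\<exists>n::nat. (norm v)\<^sup>2 < real n * area v" by (rule reals_Archimedean3[rule_format])
  qed (auto simp: not_less)
  then show ?thesis unfolding jacobi_domain_def by blast
qed

lemma openin_jacobi_domain: "openin P2_top jacobi_domain"
  unfolding jacobi_domain_Union by (intro openin_Union) (auto intro: openin_area_bound)

lemma compact_area_bound: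
  assumes "compactin P2_top K" "K \<subseteq> jacobi_domain"
  obtains M where "\<And>v. v \<noteq> 0 \<Longrightarrow> proj_pt v \<in> K \<Longrightarrow> (norm v)\<^sup>2 \<le> M * area v"
proof -
  define U where "U n = proj_pt ` {v. (norm v)\<^sup>2 < real n * area v}" for n :: nat
  have "K \<subseteq> \<Union>(range U)" using assms(2) by (simp add: jacobi_domain_Union U_def)
  moreover have "openin P2_top V" if "V \<in> range U" for V
    using that openin_area_bound by (auto simp: U_def)
  ultimately obtain \<F> where \<F>: "finite \<F>" "\<F> \<subseteq> range U" "K \<subseteq> \<Union>\<F>"
    using assms(1) unfolding compactin_def by meson
  obtain N where "finite N" "\<F> = U ` N"
    using finite_subset_image[OF \<F>(1,2)] by auto
  with \<F>(3) have N: "finite N" "K \<subseteq> (\<Union>n\<in>N. U n)" by simp_all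
  show thesis
  proof (rule that)
    fix v assume v: "v \<noteq> 0" "proj_pt v \<in> K"
    then obtain n w where n: "n \<in> N" and w: "proj_pt v = proj_pt w" "(norm w)\<^sup>2 < real n * area w"
      using N(2) unfolding U_def by blast
    obtain k where k: "k \<noteq> 0" "v = k *s w" using proj_pt_eq_imp_scale w v by metis
    have "(norm w)\<^sup>2 \<le> real (Max N) * area w"
    proof -
      have "real n * area w \<le> real (Max N) * area w"
        using n N(1) by (intro mult_right_mono) (auto simp: area_def)
      with w(2) show ?thesis by simp
    qed
    then have "(norm k)\<^sup>2 * (norm w)\<^sup>2 \<le> (norm k)\<^sup>2 * (real (Max N) * area w)"
      by (intro mult_left_mono) auto
    then show "(norm v)\<^sup>2 \<le> real (Max N) * area v"
      by (simp add: k(2) area_scale norm_scale_vec power_mult_distrib ac_simps)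
  qed
qed

text \<open>An integer combination of \<open>z\<close> and \<open>w\<close> that is small compared with the area that they span
  has small coefficients.\<close>

lemma lattice_coeffs_bounded:
  fixes z w :: complex and m n :: int
  assumes D: "D = \<bar>Im (z * cnj w)\<bar>" "D > 0"
    and "(norm z)\<^sup>2 \<le> M * D" "(norm w)\<^sup>2 \<le> M * D"
    and y: "norm (of_int m * z + of_int n * w) \<le> r * sqrt (M * D)" and r: "r \<ge> 0"
  shows "\<bar>of_int m\<bar> \<le> r * M" "\<bar>of_int n\<bar> \<le> r * M"
proof -
  let ?y = "of_int m * z + of_int n * w"
  have le: "norm z \<le> sqrt (M * D)" "norm w \<le> sqrt (M * D)"
    using assms by (simp_all add: real_le_rsqrt)
  have MD: "M * D \<ge> 0" using assms(3) by (meson order_trans zero_le_power2)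
  \<comment> \<open>Pairing with \<open>w\<close> isolates the coefficient \<open>m\<close>, and pairing with \<open>z\<close> isolates \<open>n\<close>.\<close>
  have bound: "\<bar>Im (?y * cnj u)\<bar> \<le> r * M * D" if "norm u \<le> sqrt (M * D)" for u
  proof -
    have "\<bar>Im (?y * cnj u)\<bar> \<le> norm ?y * norm u"
      by (metis abs_Im_le_cmod norm_mult complex_mod_cnj)
    also have "\<dots> \<le> (r * sqrt (M * D)) * sqrt (M * D)"
      using y that r MD by (intro mult_mono) auto
    also have "\<dots> = r * M * D" using MD by simp
    finally show ?thesis .
  qed
  have "\<bar>Im (?y * cnj w)\<bar> = \<bar>of_int m\<bar> * D" "\<bar>Im (?y * cnj z)\<bar> = \<bar>of_int n\<bar> * D"
    unfolding D(1) abs_mult[symmetric] by (simp_all add: algebra_simps abs_minus_commute)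
  with bound[OF le(2)] bound[OF le(1)] D(2) show "\<bar>of_int m\<bar> \<le> r * M" "\<bar>of_int n\<bar> \<le> r * M"
    by simp_all
qed

lemma jacobi_entries_bounded:
  assumes det: "a * d - b * c = 1"
    and D: "area v \<noteq> 0"
    and v: "(norm v)\<^sup>2 \<le> M * area v"
    and gv: "(norm (jacobi_mat p q a b c d *v v))\<^sup>2
      \<le> M * area (jacobi_mat p q a b c d *v v)" (is "(norm ?gv)\<^sup>2 \<le> _")
  shows "\<forall>n\<in>{p, q, a, b, c, d}. \<bar>real_of_int n\<bar> \<le> 2 * M"
proof -
  have pos: "area v > 0" using D by (auto simp: area_def)
  have comp: "(norm (u $ i))\<^sup>2 \<le> M * area v" if "(norm u)\<^sup>2 \<le> M * area v" for u :: "complex^3" and i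
    by (meson that Finite_Cartesian_Product.norm_nth_le norm_ge_zero order_trans power_mono)
  have gv': "(norm ?gv)\<^sup>2 \<le> M * area v" using gv area_jacobi[OF det] by simp
  have norms: "norm (v $ i) \<le> sqrt (M * area v)" "norm (?gv $ i) \<le> sqrt (M * area v)" for i
    using comp[OF v] comp[OF gv'] by (simp_all add: real_le_rsqrt)
  have M: "M \<ge> 0" using v pos by (meson order_trans zero_le_power2 zero_le_mult_iff not_less)
  note coeffs = lattice_coeffs_bounded[OF area_def pos comp[OF v] comp[OF v]]
  have "norm (of_int p * v $ 2 + of_int q * v $ 3) \<le> norm (?gv $ 1) + norm (v $ 1)"
    using norm_triangle_ineq4[of "?gv $ 1" "v $ 1"] by (simp add: jacobi_mat_vector add.assoc)
  also have "\<dots> \<le> 2 * sqrt (M * area v)" using norms[of 1] by simp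
  finally have pq: "\<bar>real_of_int p\<bar> \<le> 2 * M" "\<bar>real_of_int q\<bar> \<le> 2 * M"
    using coeffs by auto
  have ab: "\<bar>real_of_int a\<bar> \<le> 1 * M" "\<bar>real_of_int b\<bar> \<le> 1 * M"
    using norms(2)[of 2] by (intro coeffs[of a b 1]; simp add: jacobi_mat_vector)+
  have cd: "\<bar>real_of_int c\<bar> \<le> 1 * M" "\<bar>real_of_int d\<bar> \<le> 1 * M"
    using norms(2)[of 3] by (intro coeffs[of c d 1]; simp add: jacobi_mat_vector)+
  from pq ab cd M show ?thesis by auto
qed

lemma act_jacobi_domain:
  assumes "g \<in> jacobi_group"
  shows "act g ` jacobi_domain \<subseteq> jacobi_domain"
proof -
  obtain p q a b c d where g: "g = proj_class (jacobi_mat p q a b c d)" "a * d - b * c = 1"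
    using assms by (auto simp: jacobi_group_def jacobi_matrices_def)
  show ?thesis
    using area_jacobi[OF g(2)] by (auto simp: jacobi_domain_def g(1) act_proj_pt)
qed

lemma act_jacobi_domain_eq:
  assumes "g \<in> jacobi_group"
  shows "act g ` jacobi_domain = jacobi_domain"
proof
  obtain p q a b c d where g: "g = proj_class (jacobi_mat p q a b c d)" "a * d - b * c = 1"
    using assms by (auto simp: jacobi_group_def jacobi_matrices_def)
  let ?h = "jacobi_mat (q * c - p * d) (p * b - q * a) d (- b) (- c) a"
  show "jacobi_domain \<subseteq> act g ` jacobi_domain"
  proof
    fix x assume "x \<in> jacobi_domain"
    then obtain v where v: "x = proj_pt v" "area v \<noteq> 0" by (auto simp: jacobi_domain_def)
    have "act g (proj_pt (?h *v v)) = x"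
      using jacobi_mat_inverse(2)[OF g(2), of p q]
      by (simp add: g(1) act_proj_pt matrix_vector_mul_assoc v(1))
    moreover have "area (?h *v v) \<noteq> 0"
      using v(2) g(2) by (subst area_jacobi) (simp_all add: mult.commute)
    ultimately show "x \<in> act g ` jacobi_domain" unfolding jacobi_domain_def by blast
  qed
qed (rule act_jacobi_domain[OF assms])

lemma properly_discontinuous_jacobi: "properly_discontinuous_on jacobi_group jacobi_domain"
  unfolding properly_discontinuous_on_def
proof (intro allI impI)
  fix K assume K: "compactin P2_top K \<and> K \<subseteq> jacobi_domain"
  then obtain M where M: "\<And>v. v \<noteq> 0 \<Longrightarrow> proj_pt v \<in> K \<Longrightarrow> (norm v)\<^sup>2 \<le> M * area v"
    using compact_area_bound by blast
  define I where "I = {n::int. \<bar>real_of_int n\<bar> \<le> 2 * M}"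
  have "I \<subseteq> {- \<lfloor>2 * M\<rfloor>..\<lfloor>2 * M\<rfloor>}" unfolding I_def by (auto simp: le_floor_iff minus_le_iff)
  then have fin: "finite I" by (rule finite_subset) simp
  let ?f = "\<lambda>(p, q, a, b, c, d). proj_class (jacobi_mat p q a b c d)"
  have "{g \<in> jacobi_group. act g ` K \<inter> K \<noteq> {}} \<subseteq> ?f ` (I \<times> I \<times> I \<times> I \<times> I \<times> I)"
  proof
    fix g assume "g \<in> {g \<in> jacobi_group. act g ` K \<inter> K \<noteq> {}}"
    then obtain x where g: "g \<in> jacobi_group" and x: "x \<in> K" "act g x \<in> K" by auto
    obtain p q a b c d where g: "g = proj_class (jacobi_mat p q a b c d)" "a * d - b * c = 1"
      using g by (auto simp: jacobi_group_def jacobi_matrices_def)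
    obtain v where v: "x = proj_pt v" "area v \<noteq> 0" using x K by (auto simp: jacobi_domain_def)
    let ?w = "jacobi_mat p q a b c d *v v"
    have area: "area ?w \<noteq> 0" using v(2) area_jacobi[OF g(2)] by simp
    have nz: "v \<noteq> 0" "?w \<noteq> 0" using v(2) area by (auto simp: area_def)
    have "(norm v)\<^sup>2 \<le> M * area v" using M nz x v by simp
    moreover have "(norm ?w)\<^sup>2 \<le> M * area ?w"
      using M nz x(2) by (simp add: g(1) v(1) act_proj_pt)
    ultimately have "\<forall>n\<in>{p, q, a, b, c, d}. \<bar>real_of_int n\<bar> \<le> 2 * M"
      by (rule jacobi_entries_bounded[OF g(2) v(2)])
    then have "(p, q, a, b, c, d) \<in> I \<times> I \<times> I \<times> I \<times> I \<times> I" by (simp add: I_def)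
    then show "g \<in> ?f ` (I \<times> I \<times> I \<times> I \<times> I \<times> I)" unfolding g(1) by force
  qed
  then show "finite {g \<in> jacobi_group. act g ` K \<inter> K \<noteq> {}}"
    by (rule finite_subset) (intro finite_imageI finite_cartesian_product fin)
qed

lemma complex_kleinian_jacobi: "complex_kleinian jacobi_group"
proof -
  have "area (vector [0, \<i>, 1]) \<noteq> 0" by (simp add: area_def)
  then have "jacobi_domain \<noteq> {}" unfolding jacobi_domain_def by blast
  then show ?thesis
    unfolding complex_kleinian_def
    using subgroup_jacobi_group openin_jacobi_domain act_jacobi_domain_eq
      properly_discontinuous_jacobi by blast
qed

section \<open>Invariant lines of subgroups of finite index\<close>

text \<open>By the pigeonhole principle two of the \<open>f i\<close> lie in the same coset.\<close>

lemma (in group) finite_index_meets_one_parameter: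
  fixes f :: "nat \<Rightarrow> 'a"
  assumes N: "subgroup N G" "finite (rcosets N)"
    and f: "\<And>k. f k \<in> carrier G" "\<And>i k. f (k + i) = f k \<otimes> f i"
  obtains k where "k > 0" "f k \<in> N"
proof -
  have "range (\<lambda>i. N #> f i) \<subseteq> rcosets N" using f(1) by (auto simp: RCOSETS_def)
  then have "\<not> inj (\<lambda>i. N #> f i)"
    using N(2) by (meson finite_subset finite_imageD infinite_UNIV_nat)
  then obtain i j where "i < j" "N #> f i = N #> f j"
    by (metis injI linorder_neqE_nat)
  then have "f j \<in> N #> f i" using rcos_self[OF f(1) N(1)] by simp
  then obtain h where h: "h \<in> N" "f j = h \<otimes> f i" by (auto simp: r_coset_def)
  have "f j = f (j - i) \<otimes> f i" using f(2)[of "j - i" i] \<open>i < j\<close> by simp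
  then have "f (j - i) = h" using h f(1) subgroup.subset[OF N(1)] by (metis right_cancel subsetD)
  with h \<open>i < j\<close> show thesis by (intro that[of "j - i"]) auto
qed

text \<open>The four maps in the assumption are the elementary matrices \<open>E\<^sub>1\<^sub>2\<close>, \<open>E\<^sub>1\<^sub>3\<close>, \<open>E\<^sub>2\<^sub>3\<close>, \<open>E\<^sub>3\<^sub>2\<close>.\<close>

lemma no_jacobi_stable_plane:
  fixes W :: "(complex^3) set"
  assumes W: "vec.subspace W" "vec.dim W = 2"
    and stable: "\<And>v. v \<in> W \<Longrightarrow> vector [v $ 2, 0, 0] \<in> W" "\<And>v. v \<in> W \<Longrightarrow> vector [v $ 3, 0, 0] \<in> W"
      "\<And>v. v \<in> W \<Longrightarrow> vector [0, v $ 3, 0] \<in> W" "\<And>v. v \<in> W \<Longrightarrow> vector [0, 0, v $ 2] \<in> W"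
  shows False
proof -
  let ?e1 = "vector [1, 0, 0] :: complex^3"
  let ?e2 = "vector [0, 1, 0] :: complex^3"
  let ?e3 = "vector [0, 0, 1] :: complex^3"
  have scale: "k *s v \<in> W \<Longrightarrow> k \<noteq> 0 \<Longrightarrow> v \<in> W" for k and v :: "complex^3"
    using vec.subspace_scale[OF W(1), of "k *s v" "inverse k"] by simp
  have e: "vector [k, 0, 0] = k *s ?e1" "vector [0, k, 0] = k *s ?e2"
    "vector [0, 0, k] = k *s ?e3" for k
    by (simp_all add: vec_eq_iff forall_3)
  have "\<not> W \<subseteq> vec.span {?e1}"
    using vec.dim_le_card[of W "{?e1}"] W(2) by auto
  then obtain v where v: "v \<in> W" "v \<notin> vec.span {?e1}" by blast
  have "v $ 2 \<noteq> 0 \<or> v $ 3 \<noteq> 0"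
  proof (rule ccontr)
    assume "\<not> ?thesis"
    then have "v = v $ 1 *s ?e1" by (simp add: vec_eq_iff forall_3)
    with v(2) show False by (metis vec.span_base vec.span_scale singletonI)
  qed
  moreover have "?e1 \<in> W \<and> ?e3 \<in> W" if "v $ 2 \<noteq> 0"
    using stable(1,4)[OF v(1)] that scale e by metis
  moreover have "?e1 \<in> W \<and> ?e2 \<in> W" if "v $ 3 \<noteq> 0"
    using stable(2,3)[OF v(1)] that scale e by metis
  moreover have "?e2 \<in> W" if "?e3 \<in> W" using stable(3)[OF that] by simp
  moreover have "?e3 \<in> W" if "?e2 \<in> W" using stable(4)[OF that] by simp
  ultimately have in_W: "?e1 \<in> W" "?e2 \<in> W" "?e3 \<in> W" by blast+
  have "u \<in> W" for u
  proof -
    have "u = u $ 1 *s ?e1 + u $ 2 *s ?e2 + u $ 3 *s ?e3" by (simp add: vec_eq_iff forall_3)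
    then show ?thesis using in_W W(1) by (metis vec.subspace_add vec.subspace_scale)
  qed
  then have "W = UNIV" by blast
  with W(2) show False using vec_dim_card[where ?'n = 3 and ?'a = complex] by simp
qed

lemma act_stable_plane:
  assumes W: "vec.subspace W"
    and act: "act (proj_class A) ` {p \<in> P2. p \<subseteq> W} = {p \<in> P2. p \<subseteq> W}"
    and v: "v \<in> W"
  shows "A *v v \<in> W"
proof (cases "v = 0")
  case False
  have "proj_pt v \<subseteq> W" unfolding proj_pt_def using W v by (simp add: vec.span_minimal)
  then have "proj_pt v \<in> {p \<in> P2. p \<subseteq> W}" using False by (auto simp: P2_def)
  then have "proj_pt (A *v v) \<subseteq> W" using act act_proj_pt by blast
  then show ?thesis by (metis proj_pt_def vec.span_base singletonI subsetD)
qed (simp add: vec.subspace_0[OF W])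

lemma not_virtually_affine_jacobi: "\<not> virtually_affine jacobi_group"
proof
  assume "virtually_affine jacobi_group"
  then obtain N W where N: "subgroup N (PSL3\<lparr>carrier := jacobi_group\<rparr>)"
      "finite (rcosets\<^bsub>PSL3\<lparr>carrier := jacobi_group\<rparr>\<^esub> N)"
    and W: "vec.subspace W" "vec.dim W = 2"
    and act: "\<And>g. g \<in> N \<Longrightarrow> act g ` {p \<in> P2. p \<subseteq> W} = {p \<in> P2. p \<subseteq> W}"
    unfolding virtually_affine_def proj_line_def by auto
  interpret J: group "PSL3\<lparr>carrier := jacobi_group\<rparr>"
    by (rule subgroup.subgroup_is_group[OF subgroup_jacobi_group group_PSL3])
  \<comment> \<open>Here \<open>E\<close> is the value at \<open>v\<close> of the nilpotent part of the one-parameter family \<open>A\<close>.\<close>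
  have stable: "E \<in> W"
    if A: "\<And>k. A k \<in> jacobi_matrices" "\<And>i k. A (k + i) = A k ** A i"
      and E: "\<And>k. A k *v v = v + of_nat k *s E" and v: "v \<in> W"
    for A :: "nat \<Rightarrow> complex^3^3" and E v
  proof -
    have inv: "invertible (A k)" for k using A(1) jacobi_matrices_subset_GL3 by (auto simp: GL3_def)
    obtain k where k: "k > 0" "proj_class (A k) \<in> N"
      by (rule J.finite_index_meets_one_parameter[OF N, of "\<lambda>k. proj_class (A k)"])
        (auto simp: jacobi_group_def A proj_class_mult[OF inv inv])
    have "A k *v v \<in> W" by (rule act_stable_plane[OF W(1) act[OF k(2)] v])
    then have "of_nat k *s E \<in> W" using vec.subspace_diff[OF W(1) _ v] E by fastforce
    then have "inverse (of_nat k) *s (of_nat k *s E) \<in> W" by (rule vec.subspace_scale[OF W(1)])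
    with k(1) show "E \<in> W" by simp
  qed
  show False
  proof (rule no_jacobi_stable_plane[OF W])
    fix v assume v: "v \<in> W"
    show "vector [v $ 2, 0, 0] \<in> W"
      by (rule stable[OF _ _ _ v, of "\<lambda>k. jacobi_mat (int k) 0 1 0 0 1"])
        (auto simp: jacobi_mat_mem jacobi_mat_mult jacobi_mat_vector vec_eq_iff forall_3 add.commute)
    show "vector [v $ 3, 0, 0] \<in> W"
      by (rule stable[OF _ _ _ v, of "\<lambda>k. jacobi_mat 0 (int k) 1 0 0 1"])
        (auto simp: jacobi_mat_mem jacobi_mat_mult jacobi_mat_vector vec_eq_iff forall_3 add.commute)
    show "vector [0, v $ 3, 0] \<in> W"
      by (rule stable[OF _ _ _ v, of "\<lambda>k. jacobi_mat 0 0 1 (int k) 0 1"])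
        (auto simp: jacobi_mat_mem jacobi_mat_mult jacobi_mat_vector vec_eq_iff forall_3 add.commute)
    show "vector [0, 0, v $ 2] \<in> W"
      by (rule stable[OF _ _ _ v, of "\<lambda>k. jacobi_mat 0 0 1 0 (int k) 1"])
        (auto simp: jacobi_mat_mem jacobi_mat_mult jacobi_mat_vector vec_eq_iff forall_3 add.commute)
  qed
qed

section \<open>Invariant Hermitian forms\<close>

lemma adjoint_mat_mult: "adjoint_mat (A ** B) = adjoint_mat B ** adjoint_mat A"
  by (simp add: adjoint_mat_def matrix_matrix_mult_def vec_eq_iff mult.commute)

lemma adjoint_mat_mat: "adjoint_mat (mat k) = mat (cnj k)"
  by (auto simp: adjoint_mat_def mat_def vec_eq_iff)

lemma invertible_H21: "invertible H21"
proof -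
  have "H21 ** H21 = mat 1"
    by (simp add: H21_def vec_eq_iff matrix_matrix_mult_def forall_3 sum_3 mat_def)
  then show ?thesis unfolding invertible_def by blast
qed

text \<open>A group that is conjugate to a complex hyperbolic one preserves, up to factors, a
  nondegenerate Hermitian form, namely the pullback of \<open>H21\<close> along the conjugating matrix. Its Gram
  matrix serves as \<open>M\<close>; invertibility is the only further property that the argument needs.\<close>

lemma conjugate_hyperbolic_form:
  assumes hyp: "complex_hyperbolic K" "conjugate_in_PSL3 G K"
  obtains M where "invertible M"
    "\<And>A. invertible A \<Longrightarrow> proj_class A \<in> G \<Longrightarrow> \<exists>k. adjoint_mat A ** M ** A = mat k ** M"
proof -
  obtain c where c: "c \<in> carrier PSL3"
    and K: "K = (\<lambda>g. c \<otimes>\<^bsub>PSL3\<^esub> g \<otimes>\<^bsub>PSL3\<^esub> inv\<^bsub>PSL3\<^esub> c) ` G"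
    using hyp(2) unfolding conjugate_in_PSL3_def by blast
  obtain C where C: "c = proj_class C" "invertible C"
    using c by (auto simp: PSL3_def FactGroup_def RCOSETS_def GL3_def)
  then obtain B where B: "C ** B = mat 1" "B ** C = mat 1" by (auto simp: invertible_def)
  then have iB: "invertible B" by (auto simp: invertible_def)
  have adjBC: "adjoint_mat C ** adjoint_mat B = mat 1"
    using B by (metis adjoint_mat_mult adjoint_mat_mat complex_cnj_one)
  then have iC: "invertible (adjoint_mat C)"
    using matrix_left_right_inverse unfolding invertible_def by blast
  let ?M = "adjoint_mat C ** H21 ** C"
  show thesis
  proof (rule that[of ?M])
    show "invertible ?M" by (intro invertible_mult iC invertible_H21 C)
  next
    fix A assume A: "invertible A" "proj_class A \<in> G"
    have "c \<otimes>\<^bsub>PSL3\<^esub> proj_class A \<otimes>\<^bsub>PSL3\<^esub> inv\<^bsub>PSL3\<^esub> c = proj_class (C ** A ** B)"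
      by (simp add: C proj_class_inv[OF B] proj_class_mult A iB invertible_mult)
    moreover have "c \<otimes>\<^bsub>PSL3\<^esub> proj_class A \<otimes>\<^bsub>PSL3\<^esub> inv\<^bsub>PSL3\<^esub> c \<in> K"
      unfolding K using A(2) by (rule imageI)
    ultimately have "proj_class (C ** A ** B) \<in> PU21"
      using hyp(1) unfolding complex_hyperbolic_def by auto
    then obtain U where "U \<in> U21" and eq: "proj_class (C ** A ** B) = proj_class U"
      unfolding PU21_def by (rule imageE)
    then have U: "adjoint_mat U ** H21 ** U = H21" by (simp add: U21_def)
    have "C ** A ** B \<in> proj_class (C ** A ** B)"
      unfolding mem_proj_class by (rule exI[of _ 1]) simp
    then obtain k where k: "C ** A ** B = mat k ** U" unfolding eq mem_proj_class by blast
    have "C ** A = C ** A ** B ** C" by (simp add: B matrix_mul_assoc[symmetric])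
    then have CA: "C ** A = mat k ** U ** C" by (simp add: k)
    have comm: "X ** mat t = mat t ** X" for X :: "complex^3^3" and t
      by (simp add: mat_matrix_mult matrix_mult_mat)
    have "adjoint_mat A ** ?M ** A = adjoint_mat (C ** A) ** H21 ** (C ** A)"
      by (simp add: adjoint_mat_mult matrix_mul_assoc)
    also have "\<dots> = adjoint_mat C ** adjoint_mat U ** (mat (cnj k) ** H21 ** mat k) ** U ** C"
      by (simp add: CA adjoint_mat_mult adjoint_mat_mat matrix_mul_assoc)
    also have "mat (cnj k) ** H21 ** mat k = mat (cnj k * k) ** H21"
      by (simp only: matrix_mul_assoc[symmetric] comm[of H21]) (simp only: matrix_mul_assoc mat_mult_mat)
    also have "adjoint_mat C ** adjoint_mat U ** (mat (cnj k * k) ** H21) ** U ** C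
        = mat (cnj k * k) ** (adjoint_mat C ** (adjoint_mat U ** H21 ** U) ** C)"
      by (simp only: matrix_mul_assoc comm[of "adjoint_mat C ** adjoint_mat U"])
    finally show "\<exists>k. adjoint_mat A ** ?M ** A = mat k ** ?M" unfolding U by blast
  qed
qed

text \<open>Since \<open>e\<^sub>1\<close> is fixed, the first row of the Gram matrix transforms by itself: it represents
  the functional whose kernel is the orthogonal complement of \<open>e\<^sub>1\<close>.\<close>

lemma jacobi_form_first_row:
  "(adjoint_mat (jacobi_mat p q a b c d) ** M ** jacobi_mat p q a b c d) $ 1 =
   vector [M $ 1 $ 1, of_int p * M $ 1 $ 1 + of_int a * M $ 1 $ 2 + of_int c * M $ 1 $ 3,
     of_int q * M $ 1 $ 1 + of_int b * M $ 1 $ 2 + of_int d * M $ 1 $ 3]"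
  by (simp add: vec_eq_iff forall_3 matrix_matrix_mult_def sum_3 jacobi_mat_def adjoint_mat_def
      mult.commute)

lemma not_conjugate_hyperbolic_jacobi:
  assumes "complex_hyperbolic K" "conjugate_in_PSL3 jacobi_group K"
  shows False
proof -
  obtain M where M: "invertible M" and form: "\<And>A. invertible A \<Longrightarrow> proj_class A \<in> jacobi_group \<Longrightarrow>
      \<exists>k. adjoint_mat A ** M ** A = mat k ** M"
    using conjugate_hyperbolic_form[OF assms] by blast
  have row: "\<exists>k. M $ 1 $ 1 = k * M $ 1 $ 1 \<and>
      of_int p * M $ 1 $ 1 + of_int a * M $ 1 $ 2 + of_int c * M $ 1 $ 3 = k * M $ 1 $ 2 \<and>
      of_int q * M $ 1 $ 1 + of_int b * M $ 1 $ 2 + of_int d * M $ 1 $ 3 = k * M $ 1 $ 3"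
    if det: "a * d - b * c = 1" for p q a b c d
  proof -
    let ?A = "jacobi_mat p q a b c d"
    have "?A \<in> jacobi_matrices" by (rule jacobi_mat_mem[OF det])
    then obtain k where "adjoint_mat ?A ** M ** ?A = mat k ** M"
      using form jacobi_matrices_subset_GL3 by (force simp: jacobi_group_def GL3_def)
    then have "(adjoint_mat ?A ** M ** ?A) $ 1 = (mat k ** M) $ 1" by simp
    then show ?thesis
      unfolding jacobi_form_first_row by (auto simp: vec_eq_iff forall_3 mat_matrix_mult)
  qed
  \<comment> \<open>The matrices \<open>1 + E\<^sub>1\<^sub>2\<close>, \<open>1 + E\<^sub>2\<^sub>3\<close> and \<open>1 + E\<^sub>3\<^sub>2\<close> remove one entry each.\<close>
  have "M $ 1 $ 1 = 0" using row[of 1 1 0 0 1 0] by auto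
  moreover have "M $ 1 $ 2 = 0" using row[of 1 1 1 0 0 0] calculation by auto
  moreover have "M $ 1 $ 3 = 0" using row[of 1 1 0 1 0 0] calculation by auto
  ultimately have row0: "(M ** X) $ 1 $ 1 = 0" for X :: "complex^3^3"
    by (simp add: matrix_matrix_mult_def sum_3)
  obtain X where X: "M ** X = mat 1" using M by (auto simp: invertible_def)
  show False using row0[of X] unfolding X by (simp add: mat_def)
qed

theorem corollary0p3:
  shows "\<exists>G. complex_kleinian G \<and>
             \<not> (\<exists>K. complex_hyperbolic K \<and> conjugate_in_PSL3 G K) \<and>
             \<not> virtually_affine G"
  using complex_kleinian_jacobi not_conjugate_hyperbolic_jacobi not_virtually_affine_jacobi by blast

end
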